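(* Let $m,l,n$ be positive integers with $n<l$, let $\mathcal{A}$ be an $m\times l$ matrix and $\mathcal{B}$ an $l\times n$ matrix with entries in a commutative ring $R$. Let $t=\left\lceil \frac{l}{n}\right\rceil$ and let $\bar{\mathcal{B}}$ be the $l\times tn$ matrix obtained by placing $t$ copies of $\mathcal{B}$ side by side horizontally. For $0\le k<l$ put $$\bar P_k=\epsilon^k_{m\times tn}(\sigma(\mathcal{A}))\odot\omega^k_{m\times tn}(\tau(\bar{\mathcal{B}})),$$ an $m\times tn$ matrix, and for $0\le p<l$ put $$P_p=\epsilon^p_{m\times n}(\sigma(\mathcal{A}))\odot\omega^p_{m\times n}(\tau(\mathcal{B})),$$ an $m\times n$ matrix. Then: (1) for every $0\le k<l$, $\bar P_k$ contains the $t$ items $P_p$ with $p=[k]_l,[k+n]_l,\dots,[k+(t-1)n]_l$; that is, for each $0\le h<t$ the $m\times n$ submatrix of $\bar P_k$ formed by columns $hn,hn+1,\dots,hn+n-1$ equals $P_{[k+hn]_l}$; (2) the matrices $\bar P_k$, $k=0,1,\dots,n-1$, together contain all the items $P_p$, $p=0,1,\dots,l-1$; that is, for every such $p$ there are $0\le k<n$ and $0\le h<t$ such that the submatrix of $\bar P_k$ formed by columns $hn,\dots,hn+n-1$ equals $P_p$.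
   Context: All matrix indices start at $0$, and $[x]_y$ denotes $x\bmod y\in\{0,\dots,y-1\}$. $\odot$ denotes the element-wise (Hadamard) product of matrices of the same size. With $l$ fixed, for any positive integers $M,N$ and integer $k\ge 0$: For an $M\times l$ matrix $\mathcal{X}$: $\sigma(\mathcal{X})$ is the $M\times l$ matrix with $\sigma(\mathcal{X})_{i,j}=\mathcal{X}_{i,[i+j]_l}$, and $\epsilon^k_{M\times N}(\mathcal{X})$ is the $M\times N$ matrix with $\epsilon^k_{M\times N}(\mathcal{X})_{i,j}=\mathcal{X}_{i,[j+k]_l}$. For an $l\times N$ matrix $\mathcal{Y}$: $\tau(\mathcal{Y})$ is the $l\times N$ matrix with $\tau(\mathcal{Y})_{i,j}=\mathcal{Y}_{[i+j]_l,j}$, and $\omega^k_{M\times N}(\mathcal{Y})$ is the $M\times N$ matrix with $\omega^k_{M\times N}(\mathcal{Y})_{i,j}=\mathcal{Y}_{[i+k]_l,j}$. *)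

theory Defs
  imports Complex_Main "Jordan_Normal_Form.DL_Submatrix"
begin

(* Matrices have type 'a mat and are indexed from 0. The common inner dimension l is not
   passed separately: it is dim_col X for an M x l matrix X and dim_row Y for an l x N
   matrix Y. *)

definition sigma :: "'a mat \<Rightarrow> 'a mat" where
  "sigma X = mat (dim_row X) (dim_col X) (\<lambda>(i, j). X $$ (i, (i + j) mod dim_col X))"

definition epsilon :: "nat \<Rightarrow> nat \<Rightarrow> nat \<Rightarrow> 'a mat \<Rightarrow> 'a mat" where
  "epsilon k M N X = mat M N (\<lambda>(i, j). X $$ (i, (j + k) mod dim_col X))"

definition tau :: "'a mat \<Rightarrow> 'a mat" where
  "tau Y = mat (dim_row Y) (dim_col Y) (\<lambda>(i, j). Y $$ ((i + j) mod dim_row Y, j))"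

definition omega :: "nat \<Rightarrow> nat \<Rightarrow> nat \<Rightarrow> 'a mat \<Rightarrow> 'a mat" where
  "omega k M N Y = mat M N (\<lambda>(i, j). Y $$ ((i + k) mod dim_row Y, j))"

(* Only meaningful for matrices of the same size. *)
definition hadamard :: "'a::times mat \<Rightarrow> 'a mat \<Rightarrow> 'a mat" where
  "hadamard X Y = mat (dim_row X) (dim_col X) (\<lambda>(i, j). X $$ (i, j) * Y $$ (i, j))"

definition horizontal_copies :: "nat \<Rightarrow> 'a mat \<Rightarrow> 'a mat" where
  "horizontal_copies t Y = mat_of_cols (dim_row Y) (concat (replicate t (cols Y)))"

end

theory Submission
  imports Defs
begin

text \<open>Both factors are cyclic shifts, so the entry of \<open>Pbar k\<close> at row \<open>i\<close> and column \<open>c\<close> is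
  \<open>A (i, i + k + c) * B (i + k + c, c mod n)\<close> with the inner index taken modulo \<open>l\<close>. For
  \<open>c = h * n + j\<close> this is the entry of \<open>P (k + h * n)\<close> at \<open>(i, j)\<close>. Division with remainder
  \<open>p = h * n + k\<close> then locates every \<open>P p\<close>.\<close>

lemma length_concat_replicate: "length (concat (replicate t xs)) = t * length xs"
  by (induction t) auto

lemma nth_concat_replicate:
  assumes "h < t" and "j < length xs"
  shows "concat (replicate t xs) ! (h * length xs + j) = xs ! j"
  using assms
proof (induction t arbitrary: h)
  case (Suc t)
  then show ?case
    by (cases h) (auto simp: nth_append add.assoc)
qed simp

lemma dim_horizontal_copies [simp]:
  "dim_row (horizontal_copies t Y) = dim_row Y"
  "dim_col (horizontal_copies t Y) = t * dim_col Y"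
  by (simp_all add: horizontal_copies_def length_concat_replicate)

lemma block_column_less:
  fixes h t j n :: nat
  assumes "h < t" and "j < n"
  shows "h * n + j < t * n"
proof -
  have "h * n + j < Suc h * n"
    using assms(2) by simp
  also have "\<dots> \<le> t * n"
    using assms(1) by (intro mult_le_mono1) simp
  finally show ?thesis .
qed

lemma index_horizontal_copies:
  assumes "i < dim_row Y" and "h < t" and "j < dim_col Y"
  shows "horizontal_copies t Y $$ (i, h * dim_col Y + j) = Y $$ (i, j)"
  using assms block_column_less[OF assms(2,3)] nth_concat_replicate[of h t j "cols Y"]
  by (simp add: horizontal_copies_def length_concat_replicate mat_of_cols_index)

text \<open>\<open>pick\<close> enumerates a set in increasing order, and exactly \<open>j\<close>
  elements of the interval lie below \<open>a + j\<close>.\<close>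

lemma pick_atLeastLessThan:
  assumes "j < n"
  shows "pick {a..<a + n} j = a + j"
proof -
  have "{x \<in> {a..<a + n}. x < a + j} = {a..<a + j}"
    using assms by auto
  then show ?thesis
    using pick_card_in_set[of "a + j" "{a..<a + n}"] assms by simp
qed

text \<open>Replaces the enumeration by \<open>pick\<close> inside \<open>submatrix\<close> with a
  plain column offset. The bound on \<open>a + n\<close> keeps the interval from being cut off at
  the right edge of \<open>X\<close>.\<close>

lemma submatrix_consecutive_columns:
  assumes "a + n \<le> dim_col X"
  shows "submatrix X UNIV {a..<a + n} = mat (dim_row X) n (\<lambda>(i, j). X $$ (i, a + j))"
proof -
  have rows: "{i. i < dim_row X \<and> i \<in> UNIV} = {..<dim_row X}"
    by auto
  have cols: "{j. j < dim_col X \<and> j \<in> {a..<a + n}} = {a..<a + n}"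
    using assms by auto
  show ?thesis
    unfolding submatrix_def rows cols
    by (rule eq_matI) (simp_all add: pick_atLeastLessThan pick_UNIV)
qed

text \<open>The nested reductions modulo \<open>l\<close> collapse, so both factors meet at the same
  inner index. Leaving \<open>Y\<close> and \<open>N\<close> general covers \<open>B\<close> and its
  copies alike.\<close>

lemma index_sigma_tau_product:
  assumes "A \<in> carrier_mat m l" and "Y \<in> carrier_mat l N" and "0 < l" and "i < m" and "j < N"
  shows "hadamard (epsilon k m N (sigma A)) (omega k m N (tau Y)) $$ (i, j) =
    A $$ (i, (i + j + k) mod l) * Y $$ ((i + j + k) mod l, j)"
  using assms
  by (simp add: hadamard_def epsilon_def omega_def sigma_def tau_def mod_simps ac_simps)

text \<open>Part (1) with \<open>Pbar\<close> and \<open>P\<close> unfolded: the column offset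
  \<open>h * n\<close> acts on the inner index as an additional shift, and the copies of
  \<open>B\<close> absorb it in the column index.\<close>

lemma block_of_sigma_tau_product:
  assumes A: "A \<in> carrier_mat m l" and B: "B \<in> carrier_mat l n" and l: "0 < l" and h: "h < t"
  shows "submatrix (hadamard (epsilon k m (t * n) (sigma A))
        (omega k m (t * n) (tau (horizontal_copies t B)))) UNIV {h * n..<h * n + n} =
    hadamard (epsilon ((k + h * n) mod l) m n (sigma A)) (omega ((k + h * n) mod l) m n (tau B))"
    (is "submatrix ?Q UNIV _ = ?P")
proof -
  have copies: "horizontal_copies t B \<in> carrier_mat l (t * n)"
    using B by (intro carrier_matI) auto
  have dim_Q: "dim_row ?Q = m" "dim_col ?Q = t * n"
    by (simp_all add: hadamard_def epsilon_def)
  have "Suc h * n \<le> t * n"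
    using h by (intro mult_le_mono1) simp
  then have Q: "submatrix ?Q UNIV {h * n..<h * n + n} = mat m n (\<lambda>(i, j). ?Q $$ (i, h * n + j))"
    using submatrix_consecutive_columns[of "h * n" n ?Q] unfolding dim_Q by (simp add: add.commute)
  show ?thesis
    unfolding Q
  proof (rule eq_matI)
    fix i j
    assume "i < dim_row ?P" "j < dim_col ?P"
    then have i: "i < m" and j: "j < n"
      by (simp_all add: hadamard_def epsilon_def)
    define r where "r = (i + (h * n + j) + k) mod l"
    \<comment> \<open>The shift of \<open>?P\<close> is already reduced modulo \<open>l\<close>;
      under the outer reduction this makes no difference.\<close>
    have r_eq: "(i + j + (k + h * n) mod l) mod l = r"
      using mod_add_right_eq[of "i + j" "k + h * n" l] by (simp add: r_def ac_simps)
    have "r < l"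
      using l by (simp add: r_def)
    then have "horizontal_copies t B $$ (r, h * n + j) = B $$ (r, j)"
      using index_horizontal_copies[of r B h t j] B h j by auto
    then have "?Q $$ (i, h * n + j) = A $$ (i, r) * B $$ (r, j)"
      using index_sigma_tau_product[OF A copies l i block_column_less[OF h j]]
      by (simp add: r_def)
    also have "\<dots> = ?P $$ (i, j)"
      by (simp add: index_sigma_tau_product[OF A B l i j] r_eq)
    finally show "mat m n (\<lambda>(i, j). ?Q $$ (i, h * n + j)) $$ (i, j) = ?P $$ (i, j)"
      using i j by simp
  qed (simp_all add: hadamard_def epsilon_def)
qed

theorem mainTheorem7:
  fixes m l n t :: nat
    and A B Bbar :: "'a::comm_ring mat"
    and Pbar P :: "nat \<Rightarrow> 'a mat"
  assumes "0 < m" and "0 < l" and "0 < n" and "n < l"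
    and "A \<in> carrier_mat m l" and "B \<in> carrier_mat l n"
    and "t = nat \<lceil>real l / real n\<rceil>"
    and "Bbar = horizontal_copies t B"
    and "\<And>k. k < l \<Longrightarrow>
           Pbar k = hadamard (epsilon k m (t * n) (sigma A)) (omega k m (t * n) (tau Bbar))"
    and "\<And>p. p < l \<Longrightarrow>
           P p = hadamard (epsilon p m n (sigma A)) (omega p m n (tau B))"
  shows "(\<forall>k<l. \<forall>h<t. submatrix (Pbar k) UNIV {h * n..<h * n + n} = P ((k + h * n) mod l))
       \<and> (\<forall>p<l. \<exists>k<n. \<exists>h<t. submatrix (Pbar k) UNIV {h * n..<h * n + n} = P p)"
proof -
  have block: "submatrix (Pbar k) UNIV {h * n..<h * n + n} = P ((k + h * n) mod l)"
    if "k < l" "h < t" for k h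
    using block_of_sigma_tau_product[OF assms(5,6,2) that(2)] assms(2,8) that(1)
    by (simp add: assms(9,10))
  have "\<exists>k<n. \<exists>h<t. submatrix (Pbar k) UNIV {h * n..<h * n + n} = P p" if p: "p < l" for p
  \<comment> \<open>The witnesses are \<open>p mod n\<close> for \<open>k\<close> and
    \<open>p div n\<close> for \<open>h\<close>.\<close>
  proof (intro exI conjI)
    show "p mod n < n"
      using assms(3) by simp
    \<comment> \<open>The ceiling in \<open>t\<close> makes the \<open>t\<close> blocks of width
      \<open>n\<close> span at least \<open>l\<close> columns, which bounds the quotient.\<close>
    have "real l / real n \<le> real t"
      unfolding assms(7) by (rule real_nat_ceiling_ge)
    then have "real l \<le> real (t * n)"
      using assms(3) by (simp add: field_simps)
    then have "l \<le> t * n"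
      by (simp only: of_nat_le_iff)
    then show t: "p div n < t"
      using p by (intro less_mult_imp_div_less) simp
    have "p mod n < l"
      using \<open>p mod n < n\<close> assms(4) by simp
    from block[OF this t] show
      "submatrix (Pbar (p mod n)) UNIV {p div n * n..<p div n * n + n} = P p"
      \<comment> \<open>Remainder plus quotient times \<open>n\<close> recombine to
        \<open>p\<close>, which \<open>p < l\<close> leaves fixed modulo \<open>l\<close>.\<close>
      using p by (simp add: mod_div_mult_eq)
  qed
  with block show ?thesis
    by blast
qed

end
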